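(* Let $H\colon\mathbb{R}^n\to\mathbb{R}^n$ be continuous and let $\bar x\in\mathbb{R}^n$. Assume that $H$ is metrically regular around $(\bar x,H(\bar x))$, i.e., $\ker D^*H(\bar x)=\{0\}$. Then there is a constant $\varepsilon>0$ such that for all $x\in B_\varepsilon(\bar x)$ the generalized equation $$-H(x)\in DH(x)(d)$$ admits a solution $d\in\mathbb{R}^n$. Furthermore, for such $x$ the set $S(x)$ of all solutions $d$ of this generalized equation is given by $$S(x)=\operatorname*{Lim\,sup}_{t\downarrow 0,\;h\to -H(x)}\frac{H^{-1}\big(H(x)+th\big)-x}{t}\neq\emptyset .$$
   Context: $B_\varepsilon(\bar x)$ is the closed Euclidean ball of radius $\varepsilon$ centered at $\bar x$, and $H^{-1}(y)=\{x: H(x)=y\}$. Metric regularity: $H$ is metrically regular around $(\bar x,H(\bar x))$ if there are neighborhoods $U$ of $\bar x$ and $V$ of $H(\bar x)$ and $\mu>0$ such that $\mathrm{dist}(x;H^{-1}(y))\le\mu\|y-H(x)\|$ for all $x\in U$, $y\in V$ (with $\mathrm{dist}(x;\emptyset)=\infty$). Tangent cone: for $\Omega\subset\mathbb{R}^N$ and $\bar u\in\Omega$, $T(\bar u;\Omega)$ is the set of all $v$ for which there are $t_k\downarrow0$ and $v_k\to v$ with $\bar u+t_kv_k\in\Omega$ for all $k$. Graphical derivative: $DH(x)(z)=\{w\in\mathbb{R}^n: (z,w)\in T((x,H(x));\mathrm{gph}\,H)\}$, where $\mathrm{gph}\,H=\{(x,H(x))\}$. Normal cone and coderivative: $\hat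 N(u;\Omega)=\{p:\langle p,v\rangle\le0\ \forall v\in T(u;\Omega)\}$ for $u\in\Omega$ and $\hat N(u;\Omega)=\emptyset$ otherwise; $N(\bar u;\Omega)$ is the set of all limits of sequences $p_k\in\hat N(u_k;\Omega)$ with $u_k\to\bar u$; $D^*H(\bar x)(v)=\{u:(u,-v)\in N((\bar x,H(\bar x));\mathrm{gph}\,H)\}$; $\ker D^*H(\bar x)=\{v: 0\in D^*H(\bar x)(v)\}$. The condition $\ker D^*H(\bar x)=\{0\}$ is a known equivalent characterization of metric regularity around $(\bar x,H(\bar x))$. Outer limit: the $\operatorname{Lim\,sup}$ in the formula is the set of all $d$ for which there are $t_k\downarrow0$, $h_k\to-H(x)$ and $u_k\in H^{-1}(H(x)+t_kh_k)$ with $(u_k-x)/t_k\to d$. *)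

theory Defs
  imports "HOL-Analysis.Analysis"
begin

(* The library's infdist is 0 for the empty set; here the distance to the empty set is infinity,
   which is the infimum of the empty set in ereal. *)
definition dist_set :: "'a::metric_space \<Rightarrow> 'a set \<Rightarrow> ereal" where
  "dist_set x A = (INF a\<in>A. ereal (dist x a))"

definition metrically_regular_around ::
  "('a::real_normed_vector \<Rightarrow> 'b::real_normed_vector) \<Rightarrow> 'a \<Rightarrow> bool" where
  "metrically_regular_around H xbar \<longleftrightarrow>
     (\<exists>U V. open U \<and> xbar \<in> U \<and> open V \<and> H xbar \<in> V \<and>
       (\<exists>\<mu>::real. \<mu> > 0 \<and>
         (\<forall>x\<in>U. \<forall>y\<in>V. dist_set x (H -` {y}) \<le> ereal (\<mu> * norm (y - H x)))))"

(* Convergence from above, t_k \<down> 0, means positivity and convergence to 0;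
   monotonicity is not required. *)
definition downto_zero :: "(nat \<Rightarrow> real) \<Rightarrow> bool" where
  "downto_zero t \<longleftrightarrow> (\<forall>k. t k > 0) \<and> t \<longlonglongrightarrow> 0"

(* Only meaningful for u \<in> \<Omega>; every use below is at such a point. *)
definition tangent_cone :: "'a::real_normed_vector \<Rightarrow> 'a set \<Rightarrow> 'a set" where
  "tangent_cone u \<Omega> =
     {v. \<exists>t w. downto_zero t \<and> w \<longlonglongrightarrow> v \<and> (\<forall>k. u + t k *\<^sub>R w k \<in> \<Omega>)}"

definition gph :: "('a \<Rightarrow> 'b) \<Rightarrow> ('a \<times> 'b) set" where
  "gph H = {(x, H x) | x. True}"

definition graphical_derivative ::
  "('a::real_normed_vector \<Rightarrow> 'b::real_normed_vector) \<Rightarrow> 'a \<Rightarrow> 'a \<Rightarrow> 'b set" where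
  "graphical_derivative H x z = {w. (z, w) \<in> tangent_cone (x, H x) (gph H)}"

definition regular_normal_cone :: "'a::real_inner \<Rightarrow> 'a set \<Rightarrow> 'a set" where
  "regular_normal_cone u \<Omega> = (if u \<in> \<Omega> then {p. \<forall>v\<in>tangent_cone u \<Omega>. p \<bullet> v \<le> 0} else {})"

definition limiting_normal_cone :: "'a::real_inner \<Rightarrow> 'a set \<Rightarrow> 'a set" where
  "limiting_normal_cone ubar \<Omega> =
     {p. \<exists>u q. u \<longlonglongrightarrow> ubar \<and> (\<forall>k. q k \<in> regular_normal_cone (u k) \<Omega>) \<and> q \<longlonglongrightarrow> p}"

definition coderivative ::
  "('a::real_inner \<Rightarrow> 'b::real_inner) \<Rightarrow> 'a \<Rightarrow> 'b \<Rightarrow> 'a set" where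
  "coderivative H xbar v = {u. (u, - v) \<in> limiting_normal_cone (xbar, H xbar) (gph H)}"

definition ker_coderivative ::
  "('a::real_inner \<Rightarrow> 'b::real_inner) \<Rightarrow> 'a \<Rightarrow> 'b set" where
  "ker_coderivative H xbar = {v. 0 \<in> coderivative H xbar v}"

(* Lim sup of the sets F t h as t \<down> 0 and h \<rightarrow> hbar. *)
definition outer_limit ::
  "(real \<Rightarrow> 'b::topological_space \<Rightarrow> 'a::topological_space set) \<Rightarrow> 'b \<Rightarrow> 'a set" where
  "outer_limit F hbar =
     {d. \<exists>t h w. downto_zero t \<and> h \<longlonglongrightarrow> hbar \<and> (\<forall>k. w k \<in> F (t k) (h k)) \<and> w \<longlonglongrightarrow> d}"

definition preimage_quotient ::
  "('a::real_vector \<Rightarrow> 'b::real_vector) \<Rightarrow> 'a \<Rightarrow> real \<Rightarrow> 'b \<Rightarrow> 'a set" where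
  "preimage_quotient H x t h = (\<lambda>u. (u - x) /\<^sub>R t) ` (H -` {H x + t *\<^sub>R h})"

definition solution_set ::
  "('a::real_normed_vector \<Rightarrow> 'b::real_normed_vector) \<Rightarrow> 'a \<Rightarrow> 'a set" where
  "solution_set H x = {d. - H x \<in> graphical_derivative H x d}"

end

theory Submission
  imports Defs
begin

text \<open>
  The description of the solution set as an outer limit is a reparametrisation: a sequence in the graph that realises the tangent vector \<open>(d, - H x)\<close>
  consists of points \<open>(u, H u)\<close> with \<open>H u = H x + t h\<close>, and this is exactly the data of the outer
  limit. All the content is in solvability.

  If \<open>H\<close> is metrically regular, then for \<open>x\<close> near the reference point and small \<open>t > 0\<close> the equation
  \<open>H u = H x + t (- H x)\<close> has a solution \<open>u\<close> with \<open>norm (u - x) = O(t)\<close>. The quotients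
  \<open>(u - x) / t\<close> stay bounded, and a cluster point of them as \<open>t\<close> tends to zero is a solution \<open>d\<close>
  (\<open>outer_limit_nonempty_of_linear_preimages\<close>).

  It remains to derive metric regularity from triviality of the coderivative kernel. By
  compactness of the unit sphere, a trivial kernel keeps \<open>norm p\<close> above some \<open>c > 0\<close> for all regular
  normals \<open>(p, - v)\<close> to the graph with \<open>norm v = 1\<close> at points near the reference point
  (\<open>regular_normals_bounded_away\<close>). To solve \<open>H u = y\<close> near \<open>x\<close>, minimise
  \<open>norm (H u - y) + a (norm (u - x))\<^sup>2\<close> over a small closed ball around \<open>x\<close>. If \<open>H u \<noteq> y\<close>
  at the minimiser, then the objective is, as a function on the product space, differentiable at
  \<open>(u, H u)\<close>, and its negative gradient there is a regular normal \<open>(p, - v)\<close> with \<open>norm v = 1\<close> and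
  \<open>p = - 2 a (u - x)\<close>. Comparison with the value at \<open>x\<close> makes \<open>p\<close> shorter than \<open>c\<close> for a suitable \<open>a\<close>,
  which is a contradiction; the same comparison bounds \<open>norm (u - x)\<close> linearly. The
  quadratic penalty is what makes this work with regular normals alone: a penalty proportional to
  \<open>norm (u - x)\<close> could be nonsmooth at the minimiser and would require a sum rule.
\<close>

section \<open>Regular normals to a graph\<close>

text \<open>Fermat's rule: along a tangent direction a differentiable function cannot decrease to first
  order away from a constrained local minimum.\<close>
lemma neg_gradient_in_regular_normal_cone:
  fixes f :: "'a::real_inner \<Rightarrow> real"
  assumes u: "u \<in> \<Omega>"
    and deriv: "(f has_derivative (\<lambda>h. p \<bullet> h)) (at u)"
    and "r > 0" and min: "\<And>w. w \<in> \<Omega> \<Longrightarrow> dist w u < r \<Longrightarrow> f u \<le> f w"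
  shows "- p \<in> regular_normal_cone u \<Omega>"
proof -
  have "0 \<le> p \<bullet> v" if tangent: "v \<in> tangent_cone u \<Omega>" for v
  proof -
    obtain t w where t: "downto_zero t" and w: "w \<longlonglongrightarrow> v"
      and \<Omega>: "\<And>k. u + t k *\<^sub>R w k \<in> \<Omega>"
      using tangent unfolding tangent_cone_def by blast
    have tpos: "t k > 0" for k
      using t by (simp add: downto_zero_def)
    have t0: "t \<longlonglongrightarrow> 0"
      using t by (simp add: downto_zero_def)
    have tw: "(\<lambda>k. t k *\<^sub>R w k) \<longlonglongrightarrow> 0"
      using tendsto_scaleR[OF t0 w] by simp
    have approx: "0 \<le> p \<bullet> v + e * norm v" if "e > 0" for e
    proof -
      obtain d where "d > 0"
        and d: "\<And>z. norm (z - u) < d \<Longrightarrow> norm (f z - f u - p \<bullet> (z - u)) \<le> e * norm (z - u)"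
        using deriv \<open>e > 0\<close> unfolding has_derivative_at_alt by blast
      have "\<forall>\<^sub>F k in sequentially. norm (t k *\<^sub>R w k) < min d r"
        using tendstoD[OF tw, of "min d r"] \<open>d > 0\<close> \<open>r > 0\<close> by simp
      then have "\<forall>\<^sub>F k in sequentially. 0 \<le> p \<bullet> w k + e * norm (w k)"
      proof eventually_elim
        case (elim k)
        have "f u \<le> f (u + t k *\<^sub>R w k)"
          using elim \<Omega> by (intro min) (auto simp: dist_norm)
        moreover have "norm (f (u + t k *\<^sub>R w k) - f u - p \<bullet> (t k *\<^sub>R w k))
            \<le> e * norm (t k *\<^sub>R w k)"
          using d[of "u + t k *\<^sub>R w k"] elim by simp
        ultimately have "0 \<le> t k * (p \<bullet> w k + e * norm (w k))"
          using tpos[of k] by (simp add: algebra_simps abs_le_iff)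
        then show ?case
          using tpos[of k] by (simp add: zero_le_mult_iff)
      qed
      moreover have "(\<lambda>k. p \<bullet> w k + e * norm (w k)) \<longlonglongrightarrow> p \<bullet> v + e * norm v"
        by (intro tendsto_intros w)
      ultimately show ?thesis
        by (intro tendsto_lowerbound) auto
    qed
    show ?thesis
    proof (rule field_le_epsilon)
      fix e :: real assume "e > 0"
      then have "e / (norm v + 1) > 0"
        by (simp add: add_nonneg_pos)
      from approx[OF this] have "0 \<le> p \<bullet> v + e * (norm v / (norm v + 1))"
        by simp
      also have "\<dots> \<le> p \<bullet> v + e * 1"
        using \<open>e > 0\<close> by (intro add_left_mono mult_left_mono) (auto simp: divide_le_eq_1 add_nonneg_pos)
      finally show "0 \<le> p \<bullet> v + e"
        by simp
    qed
  qed
  then show ?thesis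
    using u by (simp add: regular_normal_cone_def)
qed

text \<open>Otherwise unit vectors \<open>v\<close> belonging to ever shorter \<open>p\<close> would accumulate at a unit vector in
  the kernel of the coderivative.\<close>
lemma regular_normals_bounded_away:
  fixes H :: "'a::euclidean_space \<Rightarrow> 'b::euclidean_space"
  assumes cont: "continuous_on UNIV H" and ker: "ker_coderivative H xbar = {0}"
  obtains c \<delta> :: real where "c > 0" "\<delta> > 0"
    "\<And>x p v. dist x xbar < \<delta> \<Longrightarrow> (p, - v) \<in> regular_normal_cone (x, H x) (gph H)
      \<Longrightarrow> norm v = 1 \<Longrightarrow> c \<le> norm p"
proof -
  have "\<exists>c>0. \<forall>x p v. dist x xbar < c \<longrightarrow> (p, - v) \<in> regular_normal_cone (x, H x) (gph H)
      \<longrightarrow> norm v = 1 \<longrightarrow> c \<le> norm p"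
  proof (rule ccontr)
    assume contra: "\<not> ?thesis"
    have failure: "\<exists>x p v. dist x xbar < c \<and> (p, - v) \<in> regular_normal_cone (x, H x) (gph H)
        \<and> norm v = 1 \<and> norm p < c" if "c > 0" for c
      using contra that by (simp add: not_le)
    have "\<exists>x p v. dist x xbar < inverse (real (Suc k))
        \<and> (p, - v) \<in> regular_normal_cone (x, H x) (gph H)
        \<and> norm v = 1 \<and> norm p < inverse (real (Suc k))" for k
      by (rule failure) simp
    then obtain x p v where x: "\<And>k. dist (x k) xbar < inverse (real (Suc k))"
      and normal: "\<And>k. (p k, - v k) \<in> regular_normal_cone (x k, H (x k)) (gph H)"
      and v: "\<And>k. norm (v k) = 1" and p: "\<And>k. norm (p k) < inverse (real (Suc k))"
      by metis
    have "x \<longlonglongrightarrow> xbar"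
      using x by (intro metric_tendsto_imp_tendsto[OF LIMSEQ_inverse_real_of_nat])
        (auto intro!: always_eventually less_imp_le simp del: of_nat_Suc)
    have "p \<longlonglongrightarrow> 0"
      using p by (intro metric_tendsto_imp_tendsto[OF LIMSEQ_inverse_real_of_nat])
        (auto intro!: always_eventually less_imp_le simp del: of_nat_Suc)
    have "compact (sphere 0 1 :: 'b set)" and "\<forall>k. v k \<in> sphere 0 1"
      using v by auto
    then obtain l r where l: "l \<in> sphere 0 1" and r: "strict_mono (r :: nat \<Rightarrow> nat)"
      and lim: "(v \<circ> r) \<longlonglongrightarrow> l"
      unfolding compact_def by blast
    have xr: "(\<lambda>k. x (r k)) \<longlonglongrightarrow> xbar" and pr: "(\<lambda>k. p (r k)) \<longlonglongrightarrow> 0"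
      using LIMSEQ_subseq_LIMSEQ[OF \<open>x \<longlonglongrightarrow> xbar\<close> r] LIMSEQ_subseq_LIMSEQ[OF \<open>p \<longlonglongrightarrow> 0\<close> r]
      by (simp_all add: o_def)
    have vr: "(\<lambda>k. v (r k)) \<longlonglongrightarrow> l"
      using lim by (simp add: o_def)
    have Hxr: "(\<lambda>k. H (x (r k))) \<longlonglongrightarrow> H xbar"
      using continuous_on_tendsto_compose[OF cont xr] by simp
    have "(0, - l) \<in> limiting_normal_cone (xbar, H xbar) (gph H)"
      unfolding limiting_normal_cone_def
    proof (intro CollectI exI conjI allI)
      show "(\<lambda>k. (x (r k), H (x (r k)))) \<longlonglongrightarrow> (xbar, H xbar)"
        by (intro tendsto_Pair xr Hxr)
      show "(\<lambda>k. (p (r k), - v (r k))) \<longlonglongrightarrow> (0, - l)"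
        by (intro tendsto_Pair pr tendsto_minus vr)
    qed (rule normal)
    then have "l \<in> ker_coderivative H xbar"
      by (simp add: ker_coderivative_def coderivative_def)
    then show False
      using ker l by simp
  qed
  then show thesis
    using that by blast
qed

section \<open>The coderivative criterion for metric regularity\<close>

text \<open>The minimiser of the penalised residual solves the equation, since otherwise the graph would
  have a regular normal there that violates the bound \<open>c\<close>. The condition on \<open>y\<close> forces the
  minimiser into the interior of the ball of radius \<open>\<rho>\<close>, where Fermat's rule applies.\<close>
lemma linear_preimage_of_normals_bounded_away:
  fixes H :: "'a::euclidean_space \<Rightarrow> 'b::real_inner"
  assumes cont: "continuous_on UNIV H" and "c > 0" "\<rho> > 0"
    and normals: "\<And>u p v. dist u x < \<rho> \<Longrightarrow> (p, - v) \<in> regular_normal_cone (u, H u) (gph H)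
      \<Longrightarrow> norm v = 1 \<Longrightarrow> c \<le> norm p"
    and close: "3 / c * norm (y - H x) < \<rho>"
  obtains u where "H u = y" "norm (u - x) \<le> 3 / c * norm (y - H x)"
proof (cases "H x = y")
  case True
  then show thesis
    using that[of x] by simp
next
  case False
  define s where "s = norm (H x - y)"
  have "s > 0"
    using False by (simp add: s_def)
  (* With this weight, a * q^2 \<le> s gives both 2 * a * q < c and q \<le> 3 * s / c. *)
  define a where "a = c\<^sup>2 / (9 * s)"
  have "a > 0"
    using \<open>c > 0\<close> \<open>s > 0\<close> by (simp add: a_def)
  define \<psi> where "\<psi> = (\<lambda>w. norm (snd w - y) + a * ((fst w - x) \<bullet> (fst w - x)))"
  have "continuous_on (cball x \<rho>) (\<lambda>u. \<psi> (u, H u))"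
    unfolding \<psi>_def fst_conv snd_conv
    by (intro continuous_intros continuous_on_subset[OF cont]) auto
  moreover have "cball x \<rho> \<noteq> {}"
    using \<open>\<rho> > 0\<close> by simp
  ultimately obtain u where u: "u \<in> cball x \<rho>"
    and min: "\<And>w. w \<in> cball x \<rho> \<Longrightarrow> \<psi> (u, H u) \<le> \<psi> (w, H w)"
    using continuous_attains_inf[OF compact_cball, of x \<rho> "\<lambda>u. \<psi> (u, H u)"] by blast
  define q where "q = norm (u - x)"
  have "q \<ge> 0"
    by (simp add: q_def)
  have "a * q\<^sup>2 \<le> \<psi> (u, H u)"
    by (simp add: \<psi>_def q_def power2_norm_eq_inner)
  also have "\<dots> \<le> \<psi> (x, H x)"
    using \<open>\<rho> > 0\<close> by (intro min) simp
  finally have aq: "a * q\<^sup>2 \<le> s"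
    by (simp add: \<psi>_def s_def)
  then have "(c * q)\<^sup>2 \<le> (3 * s)\<^sup>2"
    using \<open>s > 0\<close> by (simp add: a_def field_simps power2_eq_square)
  then have "c * q \<le> 3 * s"
    using \<open>s > 0\<close> by (auto intro: power2_le_imp_le)
  then have q_le: "q \<le> 3 / c * norm (y - H x)"
    using \<open>c > 0\<close> by (simp add: s_def field_simps norm_minus_commute)
  then have "q < \<rho>"
    using close by simp
  have "H u = y"
  proof (rule ccontr)
    assume "H u \<noteq> y"
    define v where "v = sgn (H u - y)"
    define p where "p = - (2 * a) *\<^sub>R (u - x)"
    have "norm v = 1"
      using \<open>H u \<noteq> y\<close> by (simp add: v_def norm_sgn)
    have distance: "((\<lambda>w. norm (snd w - y)) has_derivative (\<lambda>h. v \<bullet> snd h)) (at (u, H u))"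
    proof -
      have "(norm has_derivative (\<lambda>h. v \<bullet> h)) (at (H u - y))"
        using has_derivative_norm[of "H u - y"] \<open>H u \<noteq> y\<close> by (simp add: v_def inner_commute)
      moreover have "((\<lambda>w. snd w - y) has_derivative snd) (at (u, H u))"
        using has_derivative_diff[OF has_derivative_snd[OF has_derivative_ident]
            has_derivative_const[of y], of "at (u, H u)"] by simp
      ultimately show ?thesis
        using has_derivative_compose[of "\<lambda>w. snd w - y" snd "(u, H u)" UNIV norm] by simp
    qed
    have penalty: "((\<lambda>w. a * ((fst w - x) \<bullet> (fst w - x))) has_derivative (\<lambda>h. - p \<bullet> fst h))
        (at (u, H u))"
    proof -
      have "((\<lambda>w. fst w - x) has_derivative fst) (at (u, H u))"
        using has_derivative_diff[OF has_derivative_fst[OF has_derivative_ident]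
            has_derivative_const[of x], of "at (u, H u)"] by simp
      from has_derivative_mult_right[OF has_derivative_inner[OF this this], of a]
      show ?thesis
        by (simp add: p_def inner_commute algebra_simps)
    qed
    have "(\<psi> has_derivative (\<lambda>h. (- p, v) \<bullet> h)) (at (u, H u))"
      using has_derivative_add[OF distance penalty]
      by (simp add: \<psi>_def inner_prod_def add.commute)
    moreover have "\<psi> (u, H u) \<le> \<psi> w" if "w \<in> gph H" "dist w (u, H u) < \<rho> - q" for w
    proof -
      obtain z where w: "w = (z, H z)"
        using \<open>w \<in> gph H\<close> by (auto simp: gph_def)
      have "dist z u \<le> dist w (u, H u)"
        using dist_fst_le[of w "(u, H u)"] w by simp
      then have "dist x z \<le> \<rho>"
        using that(2) dist_triangle[of x z u] by (simp add: q_def dist_norm norm_minus_commute)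
      then show ?thesis
        using min[of z] w by simp
    qed
    ultimately have "- (- p, v) \<in> regular_normal_cone (u, H u) (gph H)"
      using \<open>q < \<rho>\<close> by (intro neg_gradient_in_regular_normal_cone[where r = "\<rho> - q"])
        (auto simp: gph_def)
    then have "c \<le> norm p"
      using \<open>norm v = 1\<close> \<open>q < \<rho>\<close> by (intro normals) (auto simp: q_def dist_norm)
    also have "norm p = 2 * a * q"
      using \<open>a > 0\<close> by (simp add: p_def q_def)
    finally have "c\<^sup>2 \<le> (2 * a * q)\<^sup>2"
      using \<open>c > 0\<close> by (intro power_mono) auto
    also have "\<dots> = 4 * a * (a * q\<^sup>2)"
      by (simp add: power2_eq_square)
    also have "\<dots> \<le> 4 * a * s"
      using aq \<open>a > 0\<close> by (intro mult_left_mono) auto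
    also have "\<dots> = 4 / 9 * c\<^sup>2"
      using \<open>s > 0\<close> by (simp add: a_def)
    finally show False
      using \<open>c > 0\<close> by simp
  qed
  then show thesis
    using that q_le by (simp add: q_def)
qed

text \<open>The sufficient half of the Mordukhovich criterion.\<close>
lemma metrically_regular_of_trivial_ker_coderivative:
  fixes H :: "'a::euclidean_space \<Rightarrow> 'b::euclidean_space"
  assumes cont: "continuous_on UNIV H" and ker: "ker_coderivative H xbar = {0}"
  shows "metrically_regular_around H xbar"
proof -
  obtain c \<delta> where "c > 0" "\<delta> > 0"
    and normals: "\<And>x p v. dist x xbar < \<delta> \<Longrightarrow> (p, - v) \<in> regular_normal_cone (x, H x) (gph H)
      \<Longrightarrow> norm v = 1 \<Longrightarrow> c \<le> norm p"
    using regular_normals_bounded_away[OF cont ker] by metis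
  define \<rho> where "\<rho> = \<delta> / 2"
  define \<eta> where "\<eta> = c * \<rho> / 6"
  have "\<rho> > 0" "\<eta> > 0"
    using \<open>c > 0\<close> \<open>\<delta> > 0\<close> by (auto simp: \<rho>_def \<eta>_def)
  define U where "U = ball xbar \<rho> \<inter> H -` ball (H xbar) \<eta>"
  define V where "V = ball (H xbar) \<eta>"
  have "open U"
    unfolding U_def using cont by (intro open_Int open_ball open_vimage)
  moreover have "dist_set x (H -` {y}) \<le> ereal (3 / c * norm (y - H x))"
    if "x \<in> U" "y \<in> V" for x y
  proof -
    have "norm (y - H x) < 2 * \<eta>"
      using that dist_triangle2[of y "H x" "H xbar"]
      by (simp add: U_def V_def dist_norm norm_minus_commute)
    then have close: "3 / c * norm (y - H x) < \<rho>"
      using \<open>c > 0\<close> by (simp add: \<eta>_def field_simps)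
    have near: "dist w xbar < \<delta>" if "dist w x < \<rho>" for w
      using that \<open>x \<in> U\<close> dist_triangle2[of w xbar x]
      by (simp add: U_def \<rho>_def dist_commute)
    obtain u where u: "H u = y" "norm (u - x) \<le> 3 / c * norm (y - H x)"
    proof (rule linear_preimage_of_normals_bounded_away[OF cont \<open>c > 0\<close> \<open>\<rho> > 0\<close> _ close])
      show "c \<le> norm p" if "dist w x < \<rho>" "norm v = 1"
        "(p, - v) \<in> regular_normal_cone (w, H w) (gph H)" for w p v
        using normals[OF near] that by blast
    qed
    have "dist_set x (H -` {y}) \<le> ereal (dist x u)"
      unfolding dist_set_def using u(1) by (intro INF_lower) simp
    also have "\<dots> \<le> ereal (3 / c * norm (y - H x))"
      using u(2) by (simp add: dist_norm norm_minus_commute)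
    finally show ?thesis .
  qed
  moreover have "xbar \<in> U" "open V" "H xbar \<in> V"
    using \<open>\<rho> > 0\<close> \<open>\<eta> > 0\<close> by (simp_all add: U_def V_def)
  moreover have "3 / c > 0"
    using \<open>c > 0\<close> by simp
  ultimately show ?thesis
    unfolding metrically_regular_around_def
    by (intro exI[of _ U] exI[of _ V] exI[of _ "3 / c"] conjI ballI)
qed

section \<open>Linear control of preimages and tangent directions\<close>

text \<open>The infimum that defines the distance need not be attained, so the constant \<open>\<mu>\<close> is doubled to
  obtain an actual preimage; continuity turns the fixed neighbourhood of \<open>H xbar\<close> into a
  neighbourhood of \<open>H x\<close> with uniform radius.\<close>
lemma linear_preimages_of_metrically_regular:
  fixes H :: "'a::real_normed_vector \<Rightarrow> 'b::real_normed_vector"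
  assumes cont: "continuous_on UNIV H" and reg: "metrically_regular_around H xbar"
  obtains \<epsilon> \<eta> \<kappa> :: real where "\<epsilon> > 0" "\<eta> > 0" "\<kappa> > 0"
    "\<And>x y. x \<in> cball xbar \<epsilon> \<Longrightarrow> norm (y - H x) < \<eta>
      \<Longrightarrow> \<exists>u. H u = y \<and> norm (u - x) \<le> \<kappa> * norm (y - H x)"
proof -
  obtain U V \<mu> where U: "open U" "xbar \<in> U" and V: "open V" "H xbar \<in> V" and "\<mu> > 0"
    and dist: "\<And>x y. x \<in> U \<Longrightarrow> y \<in> V \<Longrightarrow> dist_set x (H -` {y}) \<le> ereal (\<mu> * norm (y - H x))"
    using reg unfolding metrically_regular_around_def by metis
  obtain r where "r > 0" and r: "ball (H xbar) r \<subseteq> V"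
    using V open_contains_ball by metis
  have "open (U \<inter> H -` ball (H xbar) (r / 2))"
    using U cont by (intro open_Int open_ball open_vimage)
  moreover have "xbar \<in> U \<inter> H -` ball (H xbar) (r / 2)"
    using U \<open>r > 0\<close> by simp
  ultimately obtain \<epsilon> where "\<epsilon> > 0" and \<epsilon>: "cball xbar \<epsilon> \<subseteq> U \<inter> H -` ball (H xbar) (r / 2)"
    using open_contains_cball by metis
  show thesis
  proof (rule that[of \<epsilon> "r / 2" "2 * \<mu>"])
    fix x y assume x: "x \<in> cball xbar \<epsilon>" and y: "norm (y - H x) < r / 2"
    show "\<exists>u. H u = y \<and> norm (u - x) \<le> 2 * \<mu> * norm (y - H x)"
    proof (cases "H x = y")
      case True
      then show ?thesis
        by (intro exI[of _ x]) simp
    next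
      case False
      have "x \<in> U" "dist (H xbar) (H x) < r / 2"
        using x \<epsilon> by auto
      moreover have "dist (H xbar) y < r"
        using calculation y dist_triangle[of "H xbar" y "H x"]
        by (simp add: dist_norm norm_minus_commute)
      ultimately have "dist_set x (H -` {y}) \<le> ereal (\<mu> * norm (y - H x))"
        using r by (intro dist) auto
      also have "\<dots> < ereal (2 * \<mu> * norm (y - H x))"
        using \<open>\<mu> > 0\<close> False by simp
      finally obtain u where "u \<in> H -` {y}" "ereal (dist x u) < ereal (2 * \<mu> * norm (y - H x))"
        unfolding dist_set_def INF_less_iff by blast
      then show ?thesis
        by (intro exI[of _ u]) (simp add: dist_norm norm_minus_commute)
    qed
  qed (use \<open>\<epsilon> > 0\<close> \<open>r > 0\<close> \<open>\<mu> > 0\<close> in auto)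
qed

text \<open>The substitution \<open>u = x + t w\<close> identifies difference quotients of preimages with the sequences
  that define tangent vectors of the graph.\<close>
lemma solution_set_eq_outer_limit:
  fixes H :: "'a::real_normed_vector \<Rightarrow> 'b::real_normed_vector"
  shows "solution_set H x = outer_limit (preimage_quotient H x) (- H x)"
proof -
  have quotient: "w \<in> preimage_quotient H x t h \<longleftrightarrow> (x, H x) + t *\<^sub>R (w, h) \<in> gph H"
    if "t > 0" for t w h
  proof -
    have "w \<in> preimage_quotient H x t h \<longleftrightarrow> H (x + t *\<^sub>R w) = H x + t *\<^sub>R h"
    proof
      assume "w \<in> preimage_quotient H x t h"
      then show "H (x + t *\<^sub>R w) = H x + t *\<^sub>R h"
        using that by (auto simp: preimage_quotient_def)
    next
      assume "H (x + t *\<^sub>R w) = H x + t *\<^sub>R h"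
      then show "w \<in> preimage_quotient H x t h"
        unfolding preimage_quotient_def
        using that by (intro image_eqI[of _ _ "x + t *\<^sub>R w"]) auto
    qed
    then show ?thesis
      by (auto simp: gph_def)
  qed
  show ?thesis
  proof (intro set_eqI iffI)
    fix d assume "d \<in> solution_set H x"
    then obtain t z where t: "downto_zero t" and z: "z \<longlonglongrightarrow> (d, - H x)"
      and "\<And>k. (x, H x) + t k *\<^sub>R z k \<in> gph H"
      unfolding solution_set_def graphical_derivative_def tangent_cone_def by auto
    then have "fst (z k) \<in> preimage_quotient H x (t k) (snd (z k))" for k
      using t quotient[of "t k" "fst (z k)" "snd (z k)"]
      by (simp only: downto_zero_def prod.collapse)
    then show "d \<in> outer_limit (preimage_quotient H x) (- H x)"
      unfolding outer_limit_def
      using t tendsto_fst[OF z] tendsto_snd[OF z]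
      by (intro CollectI exI[of _ t] exI[of _ "\<lambda>k. snd (z k)"] exI[of _ "\<lambda>k. fst (z k)"]) auto
  next
    fix d assume "d \<in> outer_limit (preimage_quotient H x) (- H x)"
    then obtain t h w where t: "downto_zero t" and h: "h \<longlonglongrightarrow> - H x" and w: "w \<longlonglongrightarrow> d"
      and "\<And>k. w k \<in> preimage_quotient H x (t k) (h k)"
      unfolding outer_limit_def by auto
    then have "(x, H x) + t k *\<^sub>R (w k, h k) \<in> gph H" for k
      using quotient[of "t k"] by (auto simp: downto_zero_def)
    then show "d \<in> solution_set H x"
      unfolding solution_set_def graphical_derivative_def tangent_cone_def
      using t tendsto_Pair[OF w h]
      by (intro CollectI exI[of _ t] exI[of _ "\<lambda>k. (w k, h k)"]) auto
  qed
qed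

text \<open>Linear control of preimages bounds the difference quotients, so they cluster; the constant
  direction already serves as the sequence tending to \<open>hbar\<close>.\<close>
lemma outer_limit_nonempty_of_linear_preimages:
  fixes H :: "'a::euclidean_space \<Rightarrow> 'b::real_normed_vector"
  assumes "\<eta> > 0"
    and pre: "\<And>y. norm (y - H x) < \<eta> \<Longrightarrow> \<exists>u. H u = y \<and> norm (u - x) \<le> \<kappa> * norm (y - H x)"
  shows "outer_limit (preimage_quotient H x) hbar \<noteq> {}"
proof -
  define b where "b = \<eta> / (norm hbar + 1)"
  have "b > 0"
    using \<open>\<eta> > 0\<close> by (simp add: b_def add_nonneg_pos)
  define t where "t = (\<lambda>k. b * inverse (real (Suc k)))"
  have tpos: "t k > 0" for k
    using \<open>b > 0\<close> by (simp add: t_def)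
  have t0: "t \<longlonglongrightarrow> 0"
    unfolding t_def using tendsto_mult_right_zero[OF LIMSEQ_inverse_real_of_nat] by simp
  have "\<exists>w. w \<in> preimage_quotient H x (t k) hbar \<and> w \<in> cball 0 (\<kappa> * norm hbar)" for k
  proof -
    have "t k \<le> b"
      using \<open>b > 0\<close> by (simp add: t_def field_simps)
    then have "t k * norm hbar \<le> b * norm hbar"
      by (intro mult_right_mono) auto
    also have "\<dots> < b * (norm hbar + 1)"
      using \<open>b > 0\<close> by simp
    also have "\<dots> = \<eta>"
      using norm_ge_zero[of hbar] by (simp add: b_def add_nonneg_eq_0_iff)
    finally obtain u where u: "H u = H x + t k *\<^sub>R hbar" "norm (u - x) \<le> \<kappa> * (t k * norm hbar)"
      using pre[of "H x + t k *\<^sub>R hbar"] tpos[of k] by auto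
    have "norm ((u - x) /\<^sub>R t k) \<le> \<kappa> * norm hbar"
      using u(2) tpos[of k] by (simp add: divide_inverse_commute[symmetric] pos_divide_le_eq ac_simps)
    then show ?thesis
      using u(1) by (intro exI[of _ "(u - x) /\<^sub>R t k"]) (auto simp: preimage_quotient_def)
  qed
  then obtain w where w: "\<And>k. w k \<in> preimage_quotient H x (t k) hbar"
    and bounded: "\<forall>k. w k \<in> cball 0 (\<kappa> * norm hbar)"
    by metis
  obtain d r where r: "strict_mono (r :: nat \<Rightarrow> nat)" and lim: "(w \<circ> r) \<longlonglongrightarrow> d"
    using compact_cball[of 0 "\<kappa> * norm hbar"] bounded unfolding compact_def by metis
  have "d \<in> outer_limit (preimage_quotient H x) hbar"
    unfolding outer_limit_def
    using lim LIMSEQ_subseq_LIMSEQ[OF t0 r] tpos w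
    by (intro CollectI exI[of _ "t \<circ> r"] exI[of _ "\<lambda>_. hbar"] exI[of _ "w \<circ> r"])
      (auto simp: downto_zero_def)
  then show ?thesis
    by blast
qed

section \<open>Solvability of the Newton equation near the reference point\<close>

theorem proposition3p2:
  fixes H :: "real ^ 'n \<Rightarrow> real ^ 'n" and xbar :: "real ^ 'n"
  assumes "continuous_on UNIV H"
    and "metrically_regular_around H xbar \<or> ker_coderivative H xbar = {0}"
  shows "\<exists>\<epsilon>>0. \<forall>x\<in>cball xbar \<epsilon>.
           (\<exists>d. - H x \<in> graphical_derivative H x d) \<and>
           solution_set H x = outer_limit (preimage_quotient H x) (- H x) \<and>
           outer_limit (preimage_quotient H x) (- H x) \<noteq> {}"
proof -
  have "metrically_regular_around H xbar"
    using assms metrically_regular_of_trivial_ker_coderivative by blast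
  then obtain \<epsilon> \<eta> \<kappa> :: real where "\<epsilon> > 0" "\<eta> > 0"
    and pre: "\<And>x y. x \<in> cball xbar \<epsilon> \<Longrightarrow> norm (y - H x) < \<eta>
      \<Longrightarrow> \<exists>u. H u = y \<and> norm (u - x) \<le> \<kappa> * norm (y - H x)"
    using linear_preimages_of_metrically_regular[OF assms(1)] by metis
  show ?thesis
  proof (intro exI[of _ \<epsilon>] conjI ballI)
    fix x assume "x \<in> cball xbar \<epsilon>"
    show nonempty: "outer_limit (preimage_quotient H x) (- H x) \<noteq> {}"
      using outer_limit_nonempty_of_linear_preimages[OF \<open>\<eta> > 0\<close> pre[OF \<open>x \<in> cball xbar \<epsilon>\<close>]] .
    show solutions: "solution_set H x = outer_limit (preimage_quotient H x) (- H x)"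
      by (rule solution_set_eq_outer_limit)
    show "\<exists>d. - H x \<in> graphical_derivative H x d"
      using nonempty unfolding solutions[symmetric] solution_set_def by simp
  qed (rule \<open>\<epsilon> > 0\<close>)
qed

end
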